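(* For any function $\varepsilon : \mathbb{N} \to \mathbb{R}$ with $\varepsilon(n) \to 0$ as $n \to \infty$, there exists a sequence $\{X_n\}_{n\ge 1}$ of random variables, with $X_n$ taking values in $\{0,\ldots,n\}$ and having standard deviation $\sigma_n$ and probability generating function $P_n$, such that $\sigma_n \to \infty$, every complex root $\zeta$ of $P_n$ satisfies $|\zeta| > n^{\varepsilon(n)}$, and $\{X_n\}$ does not satisfy a central limit theorem.
   Context: The probability generating function of a random variable $X_n \in \{0,\ldots,n\}$ is the polynomial $P_n(z) = \sum_{k=0}^n \mathbb{P}(X_n = k) z^k$. A sequence $\{X_n\}$ with means $\mu_n$ and standard deviations $\sigma_n$ (positive for all large $n$) satisfies a central limit theorem if $X_n^* = (X_n - \mu_n)\sigma_n^{-1}$ converges in distribution to $Z \sim \mathcal{N}(0,1)$ as $n \to \infty$. *)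

theory Defs
  imports "HOL-Probability.Probability" "HOL-Computational_Algebra.Polynomial"
begin

definition mean :: "'a measure \<Rightarrow> ('a \<Rightarrow> nat) \<Rightarrow> real" where
  "mean M X = prob_space.expectation M (\<lambda>\<omega>. real (X \<omega>))"

definition std_dev :: "'a measure \<Rightarrow> ('a \<Rightarrow> nat) \<Rightarrow> real" where
  "std_dev M X = sqrt (prob_space.variance M (\<lambda>\<omega>. real (X \<omega>)))"

text \<open>The argument \<open>n\<close> is an upper bound for the values of \<open>X\<close>. The polynomial is taken
  over the complex numbers so that its roots are the complex ones.\<close>

definition pgf :: "nat \<Rightarrow> 'a measure \<Rightarrow> ('a \<Rightarrow> nat) \<Rightarrow> complex poly" where
  "pgf n M X = (\<Sum>k\<le>n. monom (complex_of_real (\<P>(\<omega> in M. X \<omega> = k))) k)"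

text \<open>Meaningful when the standard deviations are positive for all large \<open>n\<close>. Where a standard
  deviation is zero, division by zero makes the normalised variable constantly zero; finitely many
  such indices do not affect convergence in distribution.\<close>

definition satisfies_CLT :: "'a measure \<Rightarrow> (nat \<Rightarrow> 'a \<Rightarrow> nat) \<Rightarrow> bool" where
  "satisfies_CLT M X \<longleftrightarrow>
     weak_conv_m
       (\<lambda>n. distr M borel (\<lambda>\<omega>. (real (X n \<omega>) - mean M (X n)) / std_dev M (X n)))
       std_normal_distribution"

end

theory Submission
  imports Defs "HOL-Real_Asymp.Real_Asymp"
begin

text \<open>
  Write \<open>Bin(N, p)\<close> for the binomial distribution and take
  \<open>X\<^sub>n = k \<cdot> Bin(N, 1/(N+1))\<close> with \<open>N = n div k\<close>, where \<open>k = k\<^sub>n\<close> tends to infinity slowly.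
  Three computations make this work.

  \<^item> The generating function is \<open>((N + z\<^sup>k) / (N + 1))\<^sup>N\<close>, so every root has modulus
    \<open>N\<close> to the power \<open>1/k\<close>. For each fixed \<open>k\<close> this is about \<open>n\<close> to the power \<open>1/k\<close>, and it
    eventually exceeds \<open>n\<close> to the power \<open>\<epsilon> n\<close>, because \<open>k \<cdot> \<epsilon> n\<close> tends to zero. A diagonal
    choice of \<open>k\<^sub>n\<close> (\<open>exists_divergent_selection\<close>) keeps this inequality while
    \<open>k\<^sub>n\<close> tends to infinity.

  \<^item> The mean and the standard deviation are both \<open>k \<cdot> N / (N + 1)\<close>, so the standard
    deviation tends to infinity with \<open>k\<close>.

  \<^item> Since \<open>X\<^sub>n\<close> is nonnegative and its mean does not exceed its standard deviation, the
    normalised variable never falls below \<open>-1\<close>. The standard normal law charges the half-line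
    below \<open>-2\<close>, so it cannot be the limit (\<open>not_satisfies_CLT_if_mean_le_std_dev\<close>).

  Convergence in distribution concerns only the individual laws; the variables are taken
  independent merely to place them all on one space.
\<close>

section \<open>Dilated binomial laws\<close>

text \<open>The probabilities of a binomial law are Bernstein polynomials evaluated at its parameter,
  whose first two moments are classical.\<close>

lemma expectation_binomial_pmf_id:
  assumes "p \<in> {0..1}"
  shows "measure_pmf.expectation (binomial_pmf n p) real = real n * p"
  using sum_k_Bernstein[of n p] assms
  by (simp add: expectation_binomial_pmf' Bernstein_def mult_ac)

lemma variance_binomial_pmf:
  assumes "p \<in> {0..1}"
  shows "measure_pmf.variance (binomial_pmf n p) real = real n * p * (1 - p)"
proof -
  let ?E = "measure_pmf.expectation (binomial_pmf n p)"
  have "?E (\<lambda>j. real j * (real j - 1)) = real n * (real n - 1) * p\<^sup>2"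
    using sum_kk_Bernstein[of n p] assms
    by (simp add: expectation_binomial_pmf' Bernstein_def mult_ac)
  moreover have "?E (\<lambda>j. real j * (real j - 1)) = ?E (\<lambda>j. (real j)\<^sup>2) - ?E real"
    by (subst Bochner_Integration.integral_diff [symmetric])
       (use assms in \<open>auto simp: power2_eq_square algebra_simps\<close>)
  ultimately have "?E (\<lambda>j. (real j)\<^sup>2) = real n * (real n - 1) * p\<^sup>2 + real n * p"
    using expectation_binomial_pmf_id[OF assms] by simp
  moreover have "measure_pmf.variance (binomial_pmf n p) real = ?E (\<lambda>j. (real j)\<^sup>2) - (?E real)\<^sup>2"
    by (rule measure_pmf.variance_eq) (use assms in auto)
  ultimately show ?thesis
    using expectation_binomial_pmf_id[OF assms, of n] by (simp add: power2_eq_square algebra_simps)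
qed

lemma expectation_power_binomial_pmf:
  fixes z :: complex
  assumes "p \<in> {0..1}"
  shows "measure_pmf.expectation (binomial_pmf n p) (\<lambda>j. z ^ j) = (1 - of_real p + of_real p * z) ^ n"
proof -
  have "(of_real p * z + (1 - of_real p)) ^ n
      = (\<Sum>j\<le>n. of_nat (n choose j) * (of_real p * z) ^ j * (1 - of_real p) ^ (n - j))"
    by (rule binomial_ring)
  also have "\<dots> = measure_pmf.expectation (binomial_pmf n p) (\<lambda>j. z ^ j)"
    using assms
    by (simp add: expectation_binomial_pmf' scaleR_conv_of_real power_mult_distrib mult_ac)
  finally show ?thesis by (simp add: add.commute)
qed

text \<open>The parameter \<open>1 / (N + 1)\<close> is the one at which the mean \<open>N p\<close> and the variance
  \<open>N p (1 - p)\<close> of the binomial law satisfy mean squared = variance. Dilating by \<open>k\<close> preserves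
  this relation and replaces the roots of the generating function by their \<open>k\<close>-th roots.\<close>

definition dilated_binomial_pmf :: "nat \<Rightarrow> nat \<Rightarrow> nat pmf" where
  "dilated_binomial_pmf k N = map_pmf ((*) k) (binomial_pmf N (1 / (real N + 1)))"

lemma inverse_Suc_in_unit_interval: "1 / (real N + 1) \<in> {0..1}"
  by simp

lemma set_dilated_binomial_pmf: "set_pmf (dilated_binomial_pmf k N) \<subseteq> {..k * N}"
  using inverse_Suc_in_unit_interval[of N]
  by (auto simp: dilated_binomial_pmf_def set_pmf_binomial_eq split: if_splits)

lemma expectation_dilated_binomial_pmf:
  "measure_pmf.expectation (dilated_binomial_pmf k N) real = real k * real N / (real N + 1)"
  using expectation_binomial_pmf_id[OF inverse_Suc_in_unit_interval, of N N]
  by (simp add: dilated_binomial_pmf_def)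

lemma variance_dilated_binomial_pmf:
  "measure_pmf.variance (dilated_binomial_pmf k N) real = (real k * real N / (real N + 1))\<^sup>2"
proof -
  let ?p = "1 / (real N + 1)" and ?B = "binomial_pmf N (1 / (real N + 1))"
  have "measure_pmf.variance (dilated_binomial_pmf k N) real
      = measure_pmf.expectation ?B (\<lambda>j. (real k)\<^sup>2 * (real j - measure_pmf.expectation ?B real)\<^sup>2)"
    by (simp add: dilated_binomial_pmf_def flip: power_mult_distrib) (simp add: algebra_simps)
  also have "\<dots> = (real k)\<^sup>2 * (real N * ?p * (1 - ?p))"
    using variance_binomial_pmf[OF inverse_Suc_in_unit_interval, of N N] by simp
  also have "\<dots> = (real k * real N / (real N + 1))\<^sup>2"
    by (simp add: field_simps power2_eq_square)
  finally show ?thesis .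
qed

lemma norm_root_dilated_binomial_pmf:
  fixes z :: complex
  assumes "measure_pmf.expectation (dilated_binomial_pmf k N) (\<lambda>j. z ^ j) = 0"
  shows "N > 0" "norm z ^ k = real N"
proof -
  let ?p = "1 / (real N + 1)"
  have zero: "(1 - of_real ?p + of_real ?p * z ^ k) ^ N = 0"
    using assms expectation_power_binomial_pmf[OF inverse_Suc_in_unit_interval, of N N "z ^ k"]
    by (simp add: dilated_binomial_pmf_def power_mult)
  then show "N > 0" by (auto intro: gr0I)
  define c where "c = complex_of_real (real N + 1)"
  have "c \<noteq> 0"
    unfolding c_def of_real_eq_0_iff by simp
  then have "c * (1 - 1 / c + 1 / c * z ^ k) = z ^ k - (1 - c)"
    by (simp add: algebra_simps)
  moreover have "1 - 1 / c + 1 / c * z ^ k = 0"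
    using zero by (simp add: c_def)
  ultimately have "z ^ k = 1 - c"
    by simp
  then have "z ^ k = - of_nat N"
    by (simp add: c_def)
  then show "norm z ^ k = real N"
    by (metis norm_minus_cancel norm_of_nat norm_power)
qed

section \<open>Realising given laws by random variables\<close>

text \<open>Truncating the coordinates of the product space at \<open>n\<close> makes the bound hold at every
  point of the space instead of almost everywhere, and does not change the laws.\<close>

lemma realise_bounded_laws:
  fixes q :: "nat \<Rightarrow> nat pmf"
  assumes "\<And>n. set_pmf (q n) \<subseteq> {..n}"
  obtains M :: "(nat \<Rightarrow> nat) measure" and X :: "nat \<Rightarrow> (nat \<Rightarrow> nat) \<Rightarrow> nat"
  where "prob_space M"
    and "\<And>n. X n \<in> measurable M (count_space UNIV)"
    and "\<And>n \<omega>. X n \<omega> \<le> n"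
    and "\<And>n. distr M (count_space UNIV) (X n) = measure_pmf (q n)"
proof
  let ?M = "Pi\<^sub>M UNIV (\<lambda>n. measure_pmf (q n))" and ?X = "\<lambda>n (\<omega> :: nat \<Rightarrow> nat). min n (\<omega> n)"
  interpret product_prob_space "\<lambda>n. measure_pmf (q n)" UNIV
    by unfold_locales
  show "prob_space ?M"
    by (rule prob_space_axioms)
  have coord: "(\<lambda>\<omega>. \<omega> n) \<in> measurable ?M (measure_pmf (q n))" for n
    by (rule measurable_component_singleton) simp
  have trunc: "min n \<in> measurable (measure_pmf (q n)) (count_space UNIV)" for n :: nat
    by simp
  show "?X n \<in> measurable ?M (count_space UNIV)" for n
    using measurable_comp[OF coord trunc] by (simp add: comp_def)
  show "?X n \<omega> \<le> n" for n \<omega>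
    by simp
  show "distr ?M (count_space UNIV) (?X n) = measure_pmf (q n)" for n
  proof -
    have "distr ?M (count_space UNIV) (?X n)
        = distr (distr ?M (measure_pmf (q n)) (\<lambda>\<omega>. \<omega> n)) (count_space UNIV) (min n)"
      by (subst distr_distr[OF trunc coord]) (simp add: comp_def)
    also have "distr ?M (measure_pmf (q n)) (\<lambda>\<omega>. \<omega> n) = measure_pmf (q n)"
      by (rule PiM_component) simp
    also have "distr (measure_pmf (q n)) (count_space UNIV) (min n) = measure_pmf (map_pmf (min n) (q n))"
      by (simp add: map_pmf_rep_eq)
    also have "map_pmf (min n) (q n) = q n"
      using assms[of n] by (intro map_pmf_idI) (auto simp: min_def dest: subsetD)
    finally show ?thesis .
  qed
qed

lemma mean_eq_expectation_law:
  assumes "X \<in> measurable M (count_space UNIV)" "distr M (count_space UNIV) X = measure_pmf q"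
  shows "mean M X = measure_pmf.expectation q real"
  using integral_distr[OF assms(1), of real] assms(2) by (simp add: mean_def)

lemma std_dev_eq_sqrt_variance_law:
  assumes "X \<in> measurable M (count_space UNIV)" "distr M (count_space UNIV) X = measure_pmf q"
  shows "std_dev M X = sqrt (measure_pmf.variance q real)"
  using integral_distr[OF assms(1), of "\<lambda>x. (real x - measure_pmf.expectation q real)\<^sup>2"] assms(2)
    mean_eq_expectation_law[OF assms]
  by (simp add: std_dev_def mean_def)

lemma poly_pgf_eq_expectation_law:
  assumes X: "X \<in> measurable M (count_space UNIV)" "distr M (count_space UNIV) X = measure_pmf q"
    and "set_pmf q \<subseteq> {..n}"
  shows "poly (pgf n M X) z = measure_pmf.expectation q (\<lambda>j. z ^ j)"
proof -
  have "\<P>(\<omega> in M. X \<omega> = j) = pmf q j" for j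
    using measure_distr[OF X(1), of "{j}"] X(2)
    by (simp add: vimage_def Int_def conj_commute measure_pmf_single)
  then have "poly (pgf n M X) z = (\<Sum>j\<le>n. pmf q j *\<^sub>R z ^ j)"
    by (simp add: pgf_def poly_sum poly_monom scaleR_conv_of_real)
  also have "\<dots> = measure_pmf.expectation q (\<lambda>j. z ^ j)"
    by (rule integral_measure_pmf [symmetric]) (use assms(3) in auto)
  finally show ?thesis .
qed

section \<open>An obstruction to the central limit theorem\<close>

lemma null_sets_std_normal_iff:
  assumes "A \<in> sets borel"
  shows "A \<in> null_sets std_normal_distribution \<longleftrightarrow> A \<in> null_sets lborel"
proof -
  have "ennreal (std_normal_density x) \<noteq> 0" for x
    using normal_density_pos[of 1 0 x] by (simp add: not_le)
  then have "A \<in> null_sets std_normal_distribution \<longleftrightarrow> (AE x in lborel. x \<notin> A)"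
    using assms by (subst null_sets_density_iff) auto
  then show ?thesis
    using assms by (simp add: AE_iff_null_sets[where M = lborel])
qed

text \<open>The distribution functions of the normalised variables vanish at \<open>-2\<close>, a continuity point
  of the normal law at which its distribution function is positive.\<close>

lemma not_satisfies_CLT_if_mean_le_std_dev:
  assumes X: "\<And>n. X n \<in> measurable M (count_space UNIV)"
    and le: "\<And>n. mean M (X n) \<le> std_dev M (X n)"
  shows "\<not> satisfies_CLT M X"
proof
  let ?Y = "\<lambda>n \<omega>. (real (X n \<omega>) - mean M (X n)) / std_dev M (X n)"
  interpret N: real_distribution std_normal_distribution
    by (rule real_dist_normal_dist)
  assume "satisfies_CLT M X"
  moreover have "isCont (cdf std_normal_distribution) (-2)"
    using null_setsD1[of "{-2}" std_normal_distribution]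
    by (simp add: N.isCont_cdf measure_def null_sets_std_normal_iff finite_imp_null_set_lborel)
  ultimately have lim: "(\<lambda>n. cdf (distr M borel (?Y n)) (-2)) \<longlonglongrightarrow> cdf std_normal_distribution (-2)"
    by (simp add: satisfies_CLT_def weak_conv_m_def weak_conv_def)
  have "cdf (distr M borel (?Y n)) (-2) = 0" for n
  proof -
    have meas: "?Y n \<in> borel_measurable M"
      using measurable_compose[OF X, of "\<lambda>j. (real j - mean M (X n)) / std_dev M (X n)" borel] by simp
    \<comment> \<open>For a vanishing standard deviation the quotient is zero by the division convention.\<close>
    have ge: "?Y n \<omega> \<ge> -1" for \<omega>
    proof (cases "std_dev M (X n) > 0")
      case True
      then show ?thesis using le[of n] by (simp add: field_simps)
    next
      case False
      moreover have "std_dev M (X n) \<ge> 0"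
        by (simp add: std_dev_def integral_nonneg_AE)
      ultimately show ?thesis by simp
    qed
    have "?Y n \<omega> \<notin> {..-2}" for \<omega>
      unfolding atMost_iff using ge[of \<omega>] by linarith
    then have "?Y n -` {..-2} = {}"
      by blast
    then show ?thesis
      using meas by (simp add: cdf_def measure_distr)
  qed
  then have "cdf std_normal_distribution (-2) = 0"
    using lim by (simp add: LIMSEQ_const_iff)
  then have "{..-2 :: real} \<in> null_sets std_normal_distribution"
    by (auto simp: cdf_def null_sets_def N.emeasure_eq_measure)
  then have "{..-2 :: real} \<in> null_sets lborel"
    by (simp add: null_sets_std_normal_iff)
  then have "{-3..-2 :: real} \<in> null_sets lborel"
    by (rule null_sets_subset) auto
  then show False
    by (simp add: null_sets_def)
qed

section \<open>Slow growth of the dilation factor\<close>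

text \<open>At stage \<open>n\<close> take the largest admissible \<open>k \<le> n\<close>. A given bound \<open>K\<close> is itself
  admissible from some stage on, and the choice is at least \<open>K\<close> from then on.\<close>

lemma exists_divergent_selection:
  fixes C :: "nat \<Rightarrow> nat \<Rightarrow> bool"
  assumes "\<And>k. k > 0 \<Longrightarrow> eventually (C k) sequentially"
  shows "\<exists>\<kappa>. filterlim \<kappa> at_top sequentially \<and> (\<forall>n. \<kappa> n = 0 \<or> C (\<kappa> n) n)"
proof (intro exI conjI allI)
  define S where "S = (\<lambda>n. {k. k \<le> n \<and> (k = 0 \<or> C k n)})"
  have fin: "finite (S n)" for n
    unfolding S_def by simp
  have "Max (S n) \<in> S n" for n
    by (rule Max_in[OF fin]) (auto simp: S_def)
  then show "Max (S n) = 0 \<or> C (Max (S n)) n" for n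
    unfolding S_def by blast
  show "filterlim (\<lambda>n. Max (S n)) at_top sequentially"
    unfolding filterlim_at_top
  proof
    fix K :: nat
    have "eventually (\<lambda>n. K = 0 \<or> C K n) sequentially"
      using assms[of K] by (cases "K = 0") auto
    then show "eventually (\<lambda>n. K \<le> Max (S n)) sequentially"
      using eventually_ge_at_top[of K]
      by eventually_elim (auto intro!: Max_ge fin simp: S_def)
  qed
qed

lemma eventually_subpolynomial_power_less_div:
  fixes \<epsilon> :: "nat \<Rightarrow> real"
  assumes "\<epsilon> \<longlonglongrightarrow> 0" "k > 0"
  shows "eventually (\<lambda>n. (real n powr \<epsilon> n) ^ k < real (n div k)) sequentially"
proof -
  have "(\<lambda>n. real k * \<epsilon> n) \<longlonglongrightarrow> 0"
    using tendsto_mult_left[OF assms(1), of "real k"] by simp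
  then have "eventually (\<lambda>n. real k * \<epsilon> n < 1/2) sequentially"
    by (rule order_tendstoD) simp
  moreover have "eventually (\<lambda>n. real n powr (1/2) < real n / real k - 1) sequentially"
    using assms(2) by real_asymp
  moreover have "eventually (\<lambda>n. n \<ge> 1) sequentially"
    by (rule eventually_ge_at_top)
  ultimately show ?thesis
  proof eventually_elim
    case (elim n)
    have "(real n powr \<epsilon> n) ^ k = real n powr (real k * \<epsilon> n)"
      using elim by (simp add: powr_power mult.commute)
    also have "\<dots> \<le> real n powr (1/2)"
      using elim by (intro powr_mono) auto
    also have "\<dots> < real n / real k - 1"
      by (rule elim)
    also have "\<dots> < real (n div k)"
      using floor_divide_of_nat_eq[of n k, where ?'a = real] by linarith
    finally show ?case .
  qed
qed

section \<open>Zero-free discs without a central limit theorem\<close>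

theorem theorem18:
  fixes \<epsilon> :: "nat \<Rightarrow> real"
  assumes "\<epsilon> \<longlonglongrightarrow> 0"
  shows "\<exists>(M :: (nat \<Rightarrow> nat) measure) (X :: nat \<Rightarrow> (nat \<Rightarrow> nat) \<Rightarrow> nat).
           prob_space M \<and>
           (\<forall>n\<ge>1. X n \<in> measurable M (count_space UNIV) \<and>
                   (\<forall>\<omega>\<in>space M. X n \<omega> \<in> {0..n})) \<and>
           filterlim (\<lambda>n. std_dev M (X n)) at_top sequentially \<and>
           (\<forall>n\<ge>1. \<forall>\<zeta>::complex. poly (pgf n M (X n)) \<zeta> = 0 \<longrightarrow> norm \<zeta> > real n powr \<epsilon> n) \<and>
           \<not> satisfies_CLT M X"
proof -
  have "\<exists>\<kappa>. filterlim \<kappa> at_top sequentially \<and>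
      (\<forall>n. \<kappa> n = 0 \<or> (real n powr \<epsilon> n) ^ \<kappa> n < real (n div \<kappa> n))"
    by (rule exists_divergent_selection) (rule eventually_subpolynomial_power_less_div[OF assms])
  then obtain \<kappa> :: "nat \<Rightarrow> nat" where \<kappa>: "filterlim \<kappa> at_top sequentially"
    and adm: "\<And>n. \<kappa> n = 0 \<or> (real n powr \<epsilon> n) ^ \<kappa> n < real (n div \<kappa> n)"
    by (elim exE conjE) blast
  define N where "N = (\<lambda>n. n div \<kappa> n)"
  define q where "q = (\<lambda>n. dilated_binomial_pmf (\<kappa> n) (N n))"
  have "{..\<kappa> n * N n} \<subseteq> {..n}" for n
    by (simp add: N_def)
  then have supp: "set_pmf (q n) \<subseteq> {..n}" for n
    unfolding q_def by (rule order_trans[OF set_dilated_binomial_pmf])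
  obtain M :: "(nat \<Rightarrow> nat) measure" and X :: "nat \<Rightarrow> (nat \<Rightarrow> nat) \<Rightarrow> nat"
    where M: "prob_space M"
      and X: "\<And>n. X n \<in> measurable M (count_space UNIV)"
      and bound: "\<And>n \<omega>. X n \<omega> \<le> n"
      and law: "\<And>n. distr M (count_space UNIV) (X n) = measure_pmf (q n)"
    using realise_bounded_laws[of q, OF supp] by metis
  have mean: "mean M (X n) = real (\<kappa> n) * real (N n) / (real (N n) + 1)" for n
    using mean_eq_expectation_law[OF X law]
    by (simp add: q_def expectation_dilated_binomial_pmf)
  have std: "std_dev M (X n) = real (\<kappa> n) * real (N n) / (real (N n) + 1)" for n
    using std_dev_eq_sqrt_variance_law[OF X law]
    by (simp only: q_def variance_dilated_binomial_pmf) simp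
  have half: "1 / 2 * real (\<kappa> n) \<le> std_dev M (X n)" for n
  proof (cases "\<kappa> n = 0")
    case False
    have "0 \<le> (real n powr \<epsilon> n) ^ \<kappa> n"
      by simp
    also have "\<dots> < real (N n)"
      using adm[of n] False by (simp add: N_def)
    finally have "0 < real (N n)" .
    then have "real (N n) \<ge> 1" by simp
    then have "1 / 2 \<le> real (N n) / (real (N n) + 1)" by (simp add: field_simps)
    then have "real (\<kappa> n) * (1 / 2) \<le> real (\<kappa> n) * (real (N n) / (real (N n) + 1))"
      by (rule mult_left_mono) simp
    then show ?thesis by (simp add: std)
  qed (simp add: std)
  have "filterlim (\<lambda>n. 1 / 2 * real (\<kappa> n)) at_top sequentially"
    by (rule filterlim_tendsto_pos_mult_at_top[OF tendsto_const _
        filterlim_compose[OF filterlim_real_sequentially \<kappa>]]) simp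
  then have "filterlim (\<lambda>n. std_dev M (X n)) at_top sequentially"
    by (rule filterlim_at_top_mono) (use half in auto)
  moreover have "norm \<zeta> > real n powr \<epsilon> n" if "poly (pgf n M (X n)) \<zeta> = 0" for n and \<zeta> :: complex
  proof -
    have zero: "measure_pmf.expectation (dilated_binomial_pmf (\<kappa> n) (N n)) (\<lambda>j. \<zeta> ^ j) = 0"
      using that poly_pgf_eq_expectation_law[OF X law supp] by (simp add: q_def)
    \<comment> \<open>The degenerate choice \<open>\<kappa> n = 0\<close> gives \<open>N n = 0\<close> and a generating function without roots.\<close>
    have "\<kappa> n \<noteq> 0"
      using norm_root_dilated_binomial_pmf(1)[OF zero] by (intro notI) (simp add: N_def)
    then have "(real n powr \<epsilon> n) ^ \<kappa> n < norm \<zeta> ^ \<kappa> n"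
      using adm[of n] norm_root_dilated_binomial_pmf(2)[OF zero] by (simp add: N_def)
    then show ?thesis
      by (rule power_less_imp_less_base) simp
  qed
  moreover have "\<not> satisfies_CLT M X"
    by (rule not_satisfies_CLT_if_mean_le_std_dev[OF X]) (simp add: mean std)
  ultimately show ?thesis
    using M X bound by (intro exI[of _ M] exI[of _ X]) auto
qed

end
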